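(* Let $k \ge 0$ be an integer and let $X$ be a finite connected ray-graph with exactly $k$ rays (a $k$-legged graph). Then for every integer $n \ge 1$, the hyperspace $C_n(X)$, equipped with the Hausdorff topology, has exactly $2^k$ path-connected components.
   Context: A finite ray-graph is a space consisting of finitely many vertices (points), finitely many edges (each homeomorphic to $[0,1]$, attached at its endpoints to two vertices, or to one vertex twice) and finitely many rays (each homeomorphic to $[0,\infty)$, attached at its endpoint $0$ to one vertex). Edges and rays meet each other only at vertices. All ray-graphs considered are finite and connected. $X$ carries the arc-length metric $d$ (distance = length of a shortest path), where every edge has length one and every ray is isometrically parametrized by $[0,\infty)$. A ray-graph with exactly $k$ rays is called $k$-legged. For $n\ge 1$, $C_n(X) = \{A \subset X : A \text{ is closed},\ A \neq \emptyset,\ A \text{ has at most } n \text{ connected components}\}$. Elements of $C_n(X)$ need not be bounded. The Hausdorff topology on $C_n(X)$ is the one induced by the (possibly infinite-valued) Hausdorff metric $$d_H(A,B) = \inf\{\epsilon > 0 : A \subset N_X(B,\epsilon) \text{ and } B \subset N_X(A,\epsilon)\},$$ where $N_X(A,\epsilon)$ is the $\epsilon$-neighborhood of $A$ in $X$ and $\inf\emptyset = \infty$. *)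

theory Defs
  imports "HOL-Analysis.Analysis"
begin

section \<open>Finite connected ray-graphs\<close>

text \<open>
  Multi-edges and loops are allowed. The order of the two endpoints of an edge only fixes a
  parametrization of that edge by [0,1]. A ray starts at its base vertex.
\<close>

record ('v, 'e, 'r) ray_graph =
  verts :: "'v set"
  edges :: "'e set"
  rays :: "'r set"
  ends :: "'e \<Rightarrow> 'v \<times> 'v"
  base :: "'r \<Rightarrow> 'v"

locale finite_connected_ray_graph =
  fixes G :: "('v, 'e, 'r) ray_graph"
  assumes finite_verts: "finite (verts G)"
    and finite_edges: "finite (edges G)"
    and finite_rays: "finite (rays G)"
    and verts_nonempty: "verts G \<noteq> {}"
    and ends_in: "e \<in> edges G \<Longrightarrow> ends G e \<in> verts G \<times> verts G"
    and base_in: "r \<in> rays G \<Longrightarrow> base G r \<in> verts G"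
    and connected: "\<lbrakk>u \<in> verts G; v \<in> verts G\<rbrakk>
      \<Longrightarrow> (u, v) \<in> (ends G ` edges G \<union> (ends G ` edges G)\<inverse>)\<^sup>*"


section \<open>The underlying space and its arc-length metric\<close>

text \<open>
  Points are vertices, or points in the relative interior of an edge or of a ray.
\<close>

datatype ('v, 'e, 'r) point = Vertex 'v | Edge_Point 'e real | Ray_Point 'r real

definition points :: "('v, 'e, 'r) ray_graph \<Rightarrow> ('v, 'e, 'r) point set" where
  "points G = Vertex ` verts G
     \<union> {Edge_Point e t | e t. e \<in> edges G \<and> 0 < t \<and> t < 1}
     \<union> {Ray_Point r t | r t. r \<in> rays G \<and> 0 < t}"

text \<open>The parametrizations of the closed edges (\<open>0 \<le> t \<le> 1\<close>) and of the closed rays (\<open>0 \<le> t\<close>).\<close>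

definition edge_point :: "('v, 'e, 'r) ray_graph \<Rightarrow> 'e \<Rightarrow> real \<Rightarrow> ('v, 'e, 'r) point" where
  "edge_point G e t =
     (if t = 0 then Vertex (fst (ends G e))
      else if t = 1 then Vertex (snd (ends G e))
      else Edge_Point e t)"

definition ray_point :: "('v, 'e, 'r) ray_graph \<Rightarrow> 'r \<Rightarrow> real \<Rightarrow> ('v, 'e, 'r) point" where
  "ray_point G r t = (if t = 0 then Vertex (base G r) else Ray_Point r t)"

inductive segment ::
  "('v, 'e, 'r) ray_graph \<Rightarrow> ('v, 'e, 'r) point \<Rightarrow> ('v, 'e, 'r) point \<Rightarrow> real \<Rightarrow> bool"
  for G where
  edge: "\<lbrakk>e \<in> edges G; s \<in> {0..1}; t \<in> {0..1}\<rbrakk>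
     \<Longrightarrow> segment G (edge_point G e s) (edge_point G e t) \<bar>s - t\<bar>"
| ray: "\<lbrakk>r \<in> rays G; 0 \<le> s; 0 \<le> t\<rbrakk>
     \<Longrightarrow> segment G (ray_point G r s) (ray_point G r t) \<bar>s - t\<bar>"

text \<open>
  \<open>walk G x y l\<close>: there is a path of length \<open>l\<close> from \<open>x\<close> to \<open>y\<close> composed of finitely many
  segments, each contained in a closed edge or a closed ray.
\<close>

inductive walk ::
  "('v, 'e, 'r) ray_graph \<Rightarrow> ('v, 'e, 'r) point \<Rightarrow> ('v, 'e, 'r) point \<Rightarrow> real \<Rightarrow> bool"
  for G where
  refl: "x \<in> points G \<Longrightarrow> walk G x x 0"
| step: "\<lbrakk>segment G x y l; walk G y z m\<rbrakk> \<Longrightarrow> walk G x z (l + m)"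

text \<open>The value outside the space is irrelevant; 0 is what the locale \<open>Metric_space\<close> tolerates.\<close>

definition path_dist ::
  "('v, 'e, 'r) ray_graph \<Rightarrow> ('v, 'e, 'r) point \<Rightarrow> ('v, 'e, 'r) point \<Rightarrow> real" where
  "path_dist G x y =
     (if x \<in> points G \<and> y \<in> points G then Inf {l. walk G x y l} else 0)"

definition ray_graph_topology ::
  "('v, 'e, 'r) ray_graph \<Rightarrow> ('v, 'e, 'r) point topology" where
  "ray_graph_topology G = Metric_space.mtopology (points G) (path_dist G)"


section \<open>Hyperspaces with the Hausdorff topology\<close>

definition neighborhood ::
  "('v, 'e, 'r) ray_graph \<Rightarrow> ('v, 'e, 'r) point set \<Rightarrow> real \<Rightarrow> ('v, 'e, 'r) point set" where
  "neighborhood G A \<epsilon> = {x \<in> points G. \<exists>a\<in>A. path_dist G x a < \<epsilon>}"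

text \<open>In \<^typ>\<open>ereal\<close> the infimum of the empty set is \<open>\<infinity>\<close>.\<close>

definition hausdorff_dist ::
  "('v, 'e, 'r) ray_graph \<Rightarrow> ('v, 'e, 'r) point set \<Rightarrow> ('v, 'e, 'r) point set \<Rightarrow> ereal" where
  "hausdorff_dist G A B =
     Inf {ereal \<epsilon> | \<epsilon>. 0 < \<epsilon> \<and> A \<subseteq> neighborhood G B \<epsilon> \<and> B \<subseteq> neighborhood G A \<epsilon>}"

definition hyperspace ::
  "nat \<Rightarrow> ('v, 'e, 'r) ray_graph \<Rightarrow> ('v, 'e, 'r) point set set" where
  "hyperspace n G = {A. closedin (ray_graph_topology G) A \<and> A \<noteq> {} \<and>
     finite (connected_components_of (subtopology (ray_graph_topology G) A)) \<and>
     card (connected_components_of (subtopology (ray_graph_topology G) A)) \<le> n}"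

text \<open>
  The distance can be infinite, so \<open>Metric_space.mtopology\<close> does not apply; open sets are defined
  by the same ball condition.
\<close>

definition hyperspace_topology ::
  "nat \<Rightarrow> ('v, 'e, 'r) ray_graph \<Rightarrow> ('v, 'e, 'r) point set topology" where
  "hyperspace_topology n G = topology (\<lambda>U. U \<subseteq> hyperspace n G \<and>
     (\<forall>A\<in>U. \<exists>\<epsilon>>0. {B \<in> hyperspace n G. hausdorff_dist G A B < ereal \<epsilon>} \<subseteq> U))"


section \<open>Well-definedness\<close>

lemma openin_hyperspace_topology:
  "openin (hyperspace_topology n G) U \<longleftrightarrow> U \<subseteq> hyperspace n G \<and>
     (\<forall>A\<in>U. \<exists>\<epsilon>>0. {B \<in> hyperspace n G. hausdorff_dist G A B < ereal \<epsilon>} \<subseteq> U)"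
proof -
  let ?open = "\<lambda>U. U \<subseteq> hyperspace n G \<and>
     (\<forall>A\<in>U. \<exists>\<epsilon>>0. {B \<in> hyperspace n G. hausdorff_dist G A B < ereal \<epsilon>} \<subseteq> U)"
  have "istopology ?open"
    unfolding istopology_def
  proof (intro conjI allI impI)
    fix S T assume S: "?open S" and T: "?open T"
    show "S \<inter> T \<subseteq> hyperspace n G" using S by blast
    show "\<forall>A\<in>S \<inter> T. \<exists>\<epsilon>>0. {B \<in> hyperspace n G. hausdorff_dist G A B < ereal \<epsilon>} \<subseteq> S \<inter> T"
    proof
      fix A assume "A \<in> S \<inter> T"
      then obtain \<epsilon> \<delta> where "\<epsilon> > 0" "\<delta> > 0"
        and e: "{B \<in> hyperspace n G. hausdorff_dist G A B < ereal \<epsilon>} \<subseteq> S"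
        and d: "{B \<in> hyperspace n G. hausdorff_dist G A B < ereal \<delta>} \<subseteq> T"
        using S T by blast
      have "{B \<in> hyperspace n G. hausdorff_dist G A B < ereal (min \<epsilon> \<delta>)} \<subseteq> S \<inter> T"
        using e d by (auto elim: less_le_trans simp: subset_iff)
      moreover have "0 < min \<epsilon> \<delta>" using \<open>\<epsilon> > 0\<close> \<open>\<delta> > 0\<close> by simp
      ultimately show "\<exists>\<epsilon>>0. {B \<in> hyperspace n G. hausdorff_dist G A B < ereal \<epsilon>} \<subseteq> S \<inter> T"
        by blast
    qed
  next
    fix K assume K: "\<forall>S\<in>K. ?open S"
    show "\<Union>K \<subseteq> hyperspace n G" using K by blast
    show "\<forall>A\<in>\<Union>K. \<exists>\<epsilon>>0. {B \<in> hyperspace n G. hausdorff_dist G A B < ereal \<epsilon>} \<subseteq> \<Union>K"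
    proof
      fix A assume "A \<in> \<Union>K"
      then obtain S where "S \<in> K" "A \<in> S" by blast
      moreover from this obtain \<epsilon> where "\<epsilon> > 0"
        "{B \<in> hyperspace n G. hausdorff_dist G A B < ereal \<epsilon>} \<subseteq> S"
        using K by blast
      ultimately show "\<exists>\<epsilon>>0. {B \<in> hyperspace n G. hausdorff_dist G A B < ereal \<epsilon>} \<subseteq> \<Union>K"
        by blast
    qed
  qed
  then show ?thesis
    by (simp add: hyperspace_topology_def topology_inverse')
qed

lemma topspace_hyperspace_topology: "topspace (hyperspace_topology n G) = hyperspace n G"
proof -
  have "openin (hyperspace_topology n G) (hyperspace n G)"
    by (auto simp: openin_hyperspace_topology intro!: exI[of _ 1])
  then show ?thesis
    using openin_hyperspace_topology[of n G "topspace (hyperspace_topology n G)"]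
    by (metis openin_subset openin_topspace subset_antisym)
qed

lemma segment_nonneg: "segment G x y l \<Longrightarrow> 0 \<le> l"
  by (induction rule: segment.induct) auto

lemma walk_nonneg: "walk G x y l \<Longrightarrow> 0 \<le> l"
  by (induction rule: walk.induct) (auto dest: segment_nonneg)

lemma segment_sym: "segment G x y l \<Longrightarrow> segment G y x l"
  by (induction rule: segment.induct) (subst abs_minus_commute, simp add: segment.intros)+

lemma walk_trans: "walk G x y l \<Longrightarrow> walk G y z m \<Longrightarrow> walk G x z (l + m)"
  by (induction rule: walk.induct) (auto simp: add.assoc intro: walk.step)

lemma walk_lipschitz:
  assumes "walk G x y l" and "\<And>p q m. segment G p q m \<Longrightarrow> \<bar>f p - f q :: real\<bar> \<le> m"
  shows "\<bar>f x - f y\<bar> \<le> l"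
  using assms(1)
proof (induction rule: walk.induct)
  case (step x y l z m)
  then show ?case using assms(2)[of x y l] by linarith
qed auto

context finite_connected_ray_graph
begin

lemma edge_point_in: "e \<in> edges G \<Longrightarrow> t \<in> {0..1} \<Longrightarrow> edge_point G e t \<in> points G"
  using ends_in[of e] by (auto simp: edge_point_def points_def mem_Times_iff)

lemma ray_point_in: "r \<in> rays G \<Longrightarrow> 0 \<le> t \<Longrightarrow> ray_point G r t \<in> points G"
  using base_in[of r] by (auto simp: ray_point_def points_def)

lemma segment_in: "segment G x y l \<Longrightarrow> x \<in> points G \<and> y \<in> points G"
  by (induction rule: segment.induct) (auto simp: edge_point_in ray_point_in)

lemma segment_walk: "segment G x y l \<Longrightarrow> walk G x y l"
  by (metis add.right_neutral segment_in walk.intros)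

lemma walk_sym: "walk G x y l \<Longrightarrow> walk G y x l"
proof (induction rule: walk.induct)
  case (step x y l z m)
  then show ?case
    using walk_trans[OF step.IH segment_walk[OF segment_sym[OF step.hyps(1)]]]
    by (simp add: add.commute)
qed (rule walk.refl)

lemma walk_between_vertices:
  assumes "u \<in> verts G" "v \<in> verts G"
  shows "\<exists>l. walk G (Vertex u) (Vertex v) l"
  using connected[OF assms]
proof (induction rule: rtrancl_induct)
  case base
  then show ?case using assms(1) walk.refl[of "Vertex u" G] by (auto simp: points_def)
next
  case (step v w)
  then obtain l e where l: "walk G (Vertex u) (Vertex v) l" and e: "e \<in> edges G"
    and vw: "ends G e = (v, w) \<or> ends G e = (w, v)"
    by force
  have "segment G (Vertex (fst (ends G e))) (Vertex (snd (ends G e))) 1"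
    using segment.edge[OF e, of 0 1] by (simp add: edge_point_def)
  then have "segment G (Vertex v) (Vertex w) 1"
    using vw by (auto dest: segment_sym)
  then show ?case using l walk_trans segment_walk by blast
qed

lemma walk_to_vertex:
  assumes "x \<in> points G"
  shows "\<exists>v\<in>verts G. \<exists>l. walk G x (Vertex v) l"
  using assms unfolding points_def
proof (elim UnE)
  assume "x \<in> Vertex ` verts G"
  then show ?thesis using assms by (auto intro: walk.refl)
next
  assume "x \<in> {Edge_Point e t | e t. e \<in> edges G \<and> 0 < t \<and> t < 1}"
  then obtain e t where "x = Edge_Point e t" "e \<in> edges G" "0 < t" "t < 1" by blast
  then have "segment G x (Vertex (fst (ends G e))) t" "fst (ends G e) \<in> verts G"
    using segment.edge[of e G t 0] ends_in[of e] by (auto simp: edge_point_def mem_Times_iff)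
  then show ?thesis using segment_walk by blast
next
  assume "x \<in> {Ray_Point r t | r t. r \<in> rays G \<and> 0 < t}"
  then obtain r t where "x = Ray_Point r t" "r \<in> rays G" "0 < t" by blast
  then have "segment G x (Vertex (base G r)) t" "base G r \<in> verts G"
    using segment.ray[of r G t 0] base_in[of r] by (auto simp: ray_point_def)
  then show ?thesis using segment_walk by blast
qed

lemma walk_exists:
  assumes "x \<in> points G" "y \<in> points G"
  shows "\<exists>l. walk G x y l"
proof -
  obtain u v l m where "u \<in> verts G" "v \<in> verts G"
    and l: "walk G x (Vertex u) l" and m: "walk G y (Vertex v) m"
    using assms walk_to_vertex by meson
  then obtain n where "walk G (Vertex u) (Vertex v) n"
    using walk_between_vertices by blast
  then show ?thesis using l m walk_sym walk_trans by meson
qed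

lemma path_dist_le: "x \<in> points G \<Longrightarrow> y \<in> points G \<Longrightarrow> walk G x y l \<Longrightarrow> path_dist G x y \<le> l"
  unfolding path_dist_def by (auto intro!: cInf_lower bdd_belowI[of _ 0] dest: walk_nonneg)

lemma path_dist_ge:
  "x \<in> points G \<Longrightarrow> y \<in> points G \<Longrightarrow> (\<And>l. walk G x y l \<Longrightarrow> c \<le> l) \<Longrightarrow> c \<le> path_dist G x y"
  unfolding path_dist_def using walk_exists by (auto intro!: cInf_greatest)

text \<open>Distinct points are separated by a tent function, which is 1-Lipschitz along segments.\<close>

lemma separating_function:
  assumes "x \<in> points G" "y \<in> points G" "x \<noteq> y"
  shows "\<exists>f :: _ \<Rightarrow> real. f x \<noteq> f y \<and> (\<forall>p q m. segment G p q m \<longrightarrow> \<bar>f p - f q\<bar> \<le> m)"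
proof (cases x)
  case (Vertex v)
  define f :: "('v, 'e, 'r) point \<Rightarrow> real" where
    "f p = (case p of Vertex w \<Rightarrow> if w = v then 1/2 else 0
      | Edge_Point e s \<Rightarrow> max 0 (max (if fst (ends G e) = v then 1/2 - s else 0)
                                     (if snd (ends G e) = v then s - 1/2 else 0))
      | Ray_Point r s \<Rightarrow> if base G r = v then max 0 (1/2 - s) else 0)" for p
  have "\<bar>f p - f q\<bar> \<le> m" if "segment G p q m" for p q m
    using that
  proof cases
    case (edge e s t)
    have "f (edge_point G e s) = max 0 (max (if fst (ends G e) = v then 1/2 - s else 0)
       (if snd (ends G e) = v then s - 1/2 else 0))" if "s \<in> {0..1}" for s
      using that by (auto simp: f_def edge_point_def)
    then show ?thesis using edge by (simp add: max_def abs_if split del: if_split) (smt (verit))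
  next
    case (ray r s t)
    have "f (ray_point G r s) = (if base G r = v then max 0 (1/2 - s) else 0)" for s
      by (auto simp: f_def ray_point_def)
    then show ?thesis using ray by (auto simp: max_def abs_if split: if_splits)
  qed
  moreover have "f x \<noteq> f y"
    using assms Vertex by (auto simp: f_def points_def max_def split: if_splits)
  ultimately show ?thesis by blast
next
  case (Edge_Point e0 t0)
  then have t0: "0 < t0" "t0 < 1" using assms(1) by (auto simp: points_def)
  define f :: "('v, 'e, 'r) point \<Rightarrow> real" where
    "f p = (case p of Edge_Point e s \<Rightarrow>
        if e = e0 then max 0 (min t0 (1 - t0) - \<bar>s - t0\<bar>) else 0 | _ \<Rightarrow> 0)" for p
  have "\<bar>f p - f q\<bar> \<le> m" if "segment G p q m" for p q m
    using that
  proof cases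
    case (edge e s t)
    have "f (edge_point G e s) = (if e = e0 then max 0 (min t0 (1 - t0) - \<bar>s - t0\<bar>) else 0)" for s
      using t0 by (auto simp: f_def edge_point_def)
    then show ?thesis using edge by (simp add: max_def abs_if split del: if_split) (smt (verit))
  next
    case (ray r s t)
    then show ?thesis by (auto simp: f_def ray_point_def)
  qed
  moreover have "f x \<noteq> f y"
    using assms Edge_Point t0 by (auto simp: f_def points_def max_def min_def split: if_splits)
  ultimately show ?thesis by blast
next
  case (Ray_Point r0 t0)
  then have t0: "0 < t0" using assms(1) by (auto simp: points_def)
  define f :: "('v, 'e, 'r) point \<Rightarrow> real" where
    "f p = (case p of Ray_Point r s \<Rightarrow>
        if r = r0 then max 0 (t0 - \<bar>s - t0\<bar>) else 0 | _ \<Rightarrow> 0)" for p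
  have "\<bar>f p - f q\<bar> \<le> m" if "segment G p q m" for p q m
    using that
  proof cases
    case (edge e s t)
    then show ?thesis by (auto simp: f_def edge_point_def)
  next
    case (ray r s t)
    have "f (ray_point G r s) = (if r = r0 then max 0 (t0 - \<bar>s - t0\<bar>) else 0)" for s
      using t0 by (auto simp: f_def ray_point_def)
    then show ?thesis using ray by (auto simp: max_def abs_if split: if_splits)
  qed
  moreover have "f x \<noteq> f y"
    using assms Ray_Point t0 by (auto simp: f_def points_def max_def split: if_splits)
  ultimately show ?thesis by blast
qed

lemma Metric_space_path_dist: "Metric_space (points G) (path_dist G)"
proof
  show nonneg: "0 \<le> path_dist G x y" for x y
    using path_dist_ge[of x y 0] walk_nonneg by (fastforce simp: path_dist_def)
  have "walk G x y = walk G y x" for x y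
    using walk_sym by blast
  then show "path_dist G x y = path_dist G y x" for x y
    by (simp add: path_dist_def conj_commute)
  show "path_dist G x y = 0 \<longleftrightarrow> x = y" if xy: "x \<in> points G" "y \<in> points G" for x y
  proof
    assume eq: "path_dist G x y = 0"
    show "x = y"
    proof (rule ccontr)
      assume "x \<noteq> y"
      with separating_function[OF xy] obtain f :: "_ \<Rightarrow> real" where ne: "f x \<noteq> f y"
        and f: "\<And>p q m. segment G p q m \<Longrightarrow> \<bar>f p - f q\<bar> \<le> m" by blast
      have "\<bar>f x - f y\<bar> \<le> path_dist G x y"
        using path_dist_ge[OF xy] walk_lipschitz f by metis
      then show False using eq ne by simp
    qed
  next
    assume "x = y"
    then show "path_dist G x y = 0"
      using path_dist_le[OF xy(1) xy(1) walk.refl[OF xy(1)]] nonneg[of x x] by auto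
  qed
  show "path_dist G x z \<le> path_dist G x y + path_dist G y z"
    if xyz: "x \<in> points G" "y \<in> points G" "z \<in> points G" for x y z
  proof -
    have "path_dist G x z - m \<le> path_dist G x y" if m: "walk G y z m" for m
      using xyz path_dist_ge[of x y] path_dist_le[of x z] walk_trans[OF _ m]
      by (metis diff_le_eq)
    then have "path_dist G x z - path_dist G x y \<le> path_dist G y z"
      using xyz by (intro path_dist_ge) (auto simp: algebra_simps)
    then show ?thesis by simp
  qed
qed

end

end

theory Submission
  imports Defs
begin

text \<open>
  The invariant that separates the path components is the set of rays on which a closed set
  \<open>A\<close> is unbounded (\<open>unbounded_rays G A\<close>). Two sets at finite Hausdorff distance are
  unbounded on the same rays, because the coordinate along a ray is 1-Lipschitz. Hence the sets with
  a given invariant form an open set, these open sets partition the hyperspace, and the invariant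
  is constant along every path. It takes each of its \<open>2 ^ k\<close> possible values, as the union of the
  vertices and edges with any chosen set of rays is closed and connected.

  It remains to join \<open>A\<close> and \<open>B\<close> by a path if they are unbounded on the same rays. The basic move
  (\<open>path_component_adjoin_arc\<close>) adjoins to a set an arc that meets it: growing the arc from a common
  point is a Lipschitz path in the Hausdorff metric, and it never creates a new connected
  component. Let \<open>F\<close> be the graph with every ray cut off at some finite length. It is a union of
  finitely many arcs that hang together, so \<open>A\<close> is joined to \<open>A \<union> F\<close> as soon as \<open>A\<close> meets \<open>F\<close>
  (\<open>path_component_adjoin_truncation\<close>). If \<open>A\<close> is unbounded on a ray, then so is one of
  its finitely many components, and by connectedness it contains a tail of that ray
  (\<open>contains_tail\<close>). So \<open>A\<close> and \<open>B\<close> agree outside \<open>F\<close> if the rays are cut off far enough out, and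
  then \<open>A \<union> F = B \<union> F\<close> is joined to both.
\<close>

section \<open>Connected components of a superset\<close>

text \<open>
  Every component of \<open>B\<close> contains a component of \<open>A\<close>, and two components of \<open>B\<close> are disjoint;
  so choosing a component of \<open>A\<close> in each component of \<open>B\<close> is injective. The proof uses the
  resulting surjection in the other direction, from the components of \<open>A\<close>.
\<close>

lemma connected_components_superset:
  assumes "A \<subseteq> B" "B \<subseteq> topspace X"
    and absorb: "\<And>x. x \<in> B \<Longrightarrow> \<exists>C. connectedin X C \<and> C \<subseteq> B \<and> x \<in> C \<and> C \<inter> A \<noteq> {}"
    and fin: "finite (connected_components_of (subtopology X A))"
  shows "finite (connected_components_of (subtopology X B))"
    and "card (connected_components_of (subtopology X B))
      \<le> card (connected_components_of (subtopology X A))"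
proof -
  let ?XA = "subtopology X A" and ?XB = "subtopology X B"
  define f where "f K = connected_component_of_set ?XB (SOME y. y \<in> K)" for K
  have top: "topspace ?XA = A" "topspace ?XB = B"
    using assms(1,2) by auto
  have sub: "connected_components_of ?XB \<subseteq> f ` connected_components_of ?XA"
  proof
    fix D assume "D \<in> connected_components_of ?XB"
    then obtain x where x: "x \<in> B" and D: "D = connected_component_of_set ?XB x"
      using top by (auto simp: connected_components_of_def)
    then obtain C a where C: "connectedin X C" "C \<subseteq> B" "x \<in> C" "a \<in> C" "a \<in> A"
      using absorb by blast
    have xa: "connected_component_of ?XB x a"
      unfolding connected_component_of_def connectedin_subtopology using C by blast
    define K where "K = connected_component_of_set ?XA a"
    have K: "K \<in> connected_components_of ?XA"
      using C top by (auto simp: K_def connected_components_of_def)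
    have "a \<in> K"
      using C top by (auto simp: K_def connected_component_of_refl)
    then have y: "(SOME y. y \<in> K) \<in> K"
      by (rule someI)
    have "connectedin ?XB K"
      using connectedin_connected_components_of[OF K] assms(1)
      by (auto simp: connectedin_subtopology)
    then have "connected_component_of ?XB a (SOME y. y \<in> K)"
      unfolding connected_component_of_def using \<open>a \<in> K\<close> y by blast
    with xa have "connected_component_of ?XB x (SOME y. y \<in> K)"
      by (rule connected_component_of_trans)
    then have "D = f K"
      unfolding D f_def by (metis connected_component_of_equiv)
    then show "D \<in> f ` connected_components_of ?XA"
      using K by blast
  qed
  show "finite (connected_components_of ?XB)"
    using finite_subset[OF sub] fin by blast
  show "card (connected_components_of ?XB) \<le> card (connected_components_of ?XA)"
    using surj_card_le[OF fin sub] .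
qed


section \<open>Lipschitz paths in the hyperspace\<close>

text \<open>
  The Lipschitz condition is phrased with one-sided neighbourhoods. Exchanging \<open>s\<close> and \<open>t\<close> gives
  the other inclusion in the definition of the Hausdorff distance.
\<close>

lemma lipschitz_imp_path_component_of:
  fixes g :: "real \<Rightarrow> ('v, 'e, 'r) point set"
  assumes g: "\<And>t. t \<in> {0..1} \<Longrightarrow> g t \<in> hyperspace n G"
    and lip: "\<And>s t \<epsilon>. s \<in> {0..1} \<Longrightarrow> t \<in> {0..1} \<Longrightarrow> L * \<bar>s - t\<bar> < \<epsilon>
      \<Longrightarrow> g s \<subseteq> neighborhood G (g t) \<epsilon>"
    and L: "0 \<le> L"
  shows "path_component_of (hyperspace_topology n G) (g 0) (g 1)"
proof -
  have "openin (top_of_set {0..1}) {t \<in> {0..1}. g t \<in> U}"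
    if U: "openin (hyperspace_topology n G) U" for U
    unfolding openin_euclidean_subtopology_iff
  proof (intro conjI ballI)
    fix t assume t: "t \<in> {t \<in> {0..1}. g t \<in> U}"
    then obtain \<epsilon> where \<epsilon>: "\<epsilon> > 0"
      "{B \<in> hyperspace n G. hausdorff_dist G (g t) B < ereal \<epsilon>} \<subseteq> U"
      using U by (auto simp: openin_hyperspace_topology)
    define \<delta> where "\<delta> = \<epsilon> / (2 * (L + 1))"
    have "\<delta> > 0" using \<epsilon> L by (simp add: \<delta>_def)
    moreover have "g s \<in> U" if s: "s \<in> {0..1}" "dist s t < \<delta>" for s
    proof -
      have "L * \<bar>s - t\<bar> \<le> (L + 1) * \<bar>s - t\<bar>"
        by (simp add: mult_right_mono)
      also have "\<dots> < (L + 1) * \<delta>"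
        using s L by (intro mult_strict_left_mono) (auto simp: dist_real_def)
      also have "\<dots> = \<epsilon> / 2"
        using L by (simp add: \<delta>_def field_simps)
      finally have *: "L * \<bar>s - t\<bar> < \<epsilon> / 2" .
      then have "g s \<subseteq> neighborhood G (g t) (\<epsilon> / 2)" "g t \<subseteq> neighborhood G (g s) (\<epsilon> / 2)"
        using lip[of s t] lip[of t s] s t by (auto simp: abs_minus_commute)
      then have "hausdorff_dist G (g t) (g s) \<le> ereal (\<epsilon> / 2)"
        unfolding hausdorff_dist_def using \<epsilon>(1)
        by (intro Inf_lower CollectI exI[of _ "\<epsilon> / 2"]) auto
      also have "\<dots> < ereal \<epsilon>" using \<epsilon>(1) by simp
      finally show ?thesis using \<epsilon>(2) g[OF s(1)] by blast
    qed
    ultimately show "\<exists>\<delta>>0. \<forall>s\<in>{0..1}. dist s t < \<delta> \<longrightarrow> s \<in> {t \<in> {0..1}. g t \<in> U}"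
      by blast
  qed auto
  then have "pathin (hyperspace_topology n G) g"
    using g by (auto simp: pathin_def continuous_map_def topspace_hyperspace_topology)
  then show ?thesis
    by (auto simp: path_component_of_def)
qed


section \<open>Adjoining members of a finite family of sets\<close>

text \<open>
  Adjoining intersecting members of \<open>\<C>\<close> one after the other must stop, since \<open>\<C>\<close> is finite;
  a maximal subfamily that can be reached then has no further neighbours in \<open>\<C>\<close>.
\<close>

lemma path_component_of_saturated_Union:
  fixes T :: "'a set topology"
  assumes A: "A \<in> topspace T" and fin: "finite \<C>"
    and step: "\<And>B C. B \<in> topspace T \<Longrightarrow> C \<in> \<C> \<Longrightarrow> C \<inter> B \<noteq> {} \<Longrightarrow> path_component_of T B (B \<union> C)"
  obtains \<D> where "\<D> \<subseteq> \<C>" "path_component_of T A (A \<union> \<Union>\<D>)"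
    "\<And>C. C \<in> \<C> \<Longrightarrow> C \<inter> (A \<union> \<Union>\<D>) \<noteq> {} \<Longrightarrow> C \<in> \<D>"
proof -
  define \<P> where
    "\<P> = {\<D>. \<D> \<subseteq> \<C> \<and> path_component_of T A (A \<union> \<Union>\<D>)}"
  have "finite \<P>" using fin by (simp add: \<P>_def)
  moreover have "{} \<in> \<P>"
    using A by (simp add: \<P>_def path_component_of_refl)
  ultimately have "\<exists>\<D>\<in>\<P>. \<forall>\<E>\<in>\<P>. \<D> \<subseteq> \<E> \<longrightarrow> \<D> = \<E>"
    by (intro finite_has_maximal) auto
  then obtain \<D> where \<D>_P: "\<D> \<in> \<P>" and max: "\<forall>\<E>\<in>\<P>. \<D> \<subseteq> \<E> \<longrightarrow> \<D> = \<E>" ..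
  have \<D>: "\<D> \<subseteq> \<C>" "path_component_of T A (A \<union> \<Union>\<D>)"
    using \<D>_P by (simp_all add: \<P>_def)
  have "C \<in> \<D>" if C: "C \<in> \<C>" "C \<inter> (A \<union> \<Union>\<D>) \<noteq> {}" for C
  proof -
    have "A \<union> \<Union>\<D> \<in> topspace T"
      using path_component_in_topspace[OF \<D>(2)] by simp
    then have "path_component_of T (A \<union> \<Union>\<D>) (A \<union> \<Union>\<D> \<union> C)"
      using C by (rule step)
    with \<D>(2) have "path_component_of T A (A \<union> \<Union>\<D> \<union> C)"
      by (rule path_component_of_trans)
    then have "insert C \<D> \<in> \<P>"
      using \<D>(1) C(1) by (simp add: \<P>_def Un_ac)
    then show ?thesis using max by blast
  qed
  then show thesis using that[OF \<D>] by blast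
qed


section \<open>The coordinate along a ray\<close>

text \<open>
  The arc-length along the ray \<open>r\<close>, extended by 0 to the rest of the graph. It is 1-Lipschitz for the
  path metric, which turns statements about ends of the graph into statements about real numbers.
\<close>

definition ray_coord :: "'r \<Rightarrow> ('v, 'e, 'r) point \<Rightarrow> real" where
  "ray_coord r p = (case p of Ray_Point r' t \<Rightarrow> if r' = r then t else 0 | _ \<Rightarrow> 0)"

lemma ray_coord_simps [simp]:
  "ray_coord r (Vertex v) = 0"
  "ray_coord r (Edge_Point e t) = 0"
  "ray_coord r (Ray_Point r' t) = (if r' = r then t else 0)"
  "ray_coord r (edge_point G e t) = 0"
  "ray_coord r (ray_point G r' t) = (if r' = r then t else 0)"
  by (auto simp: ray_coord_def edge_point_def ray_point_def)

lemma ray_coord_pos: "0 < ray_coord r p \<Longrightarrow> p = Ray_Point r (ray_coord r p)"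
  by (cases p) (auto split: if_splits)

definition unbounded_rays ::
  "('v, 'e, 'r) ray_graph \<Rightarrow> ('v, 'e, 'r) point set \<Rightarrow> 'r set" where
  "unbounded_rays G A = {r \<in> rays G. \<forall>c. \<exists>p\<in>A. c < ray_coord r p}"

definition truncation :: "('v, 'e, 'r) ray_graph \<Rightarrow> ('r \<Rightarrow> real) \<Rightarrow> ('v, 'e, 'r) point set" where
  "truncation G c = {p \<in> points G. \<forall>r\<in>rays G. ray_coord r p \<le> c r}"

text \<open>
  The parametrization is required to be 1-Lipschitz, not just continuous, in order that growing the
  arc moves a set at bounded speed in the Hausdorff metric.
\<close>

definition lipschitz_arc :: "('v, 'e, 'r) ray_graph \<Rightarrow> ('v, 'e, 'r) point set \<Rightarrow> bool" where
  "lipschitz_arc G C \<longleftrightarrow> (\<exists>\<sigma> a b. C = \<sigma> ` {a..b} \<and> C \<subseteq> points G \<and>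
     (\<forall>s\<in>{a..b}. \<forall>t\<in>{a..b}. path_dist G (\<sigma> s) (\<sigma> t) \<le> \<bar>s - t\<bar>))"

context finite_connected_ray_graph
begin

interpretation M: Metric_space "points G" "path_dist G"
  by (rule Metric_space_path_dist)

lemma mtopology_eq: "M.mtopology = ray_graph_topology G"
  by (simp add: ray_graph_topology_def)

lemma topspace_ray_graph_topology [simp]: "topspace (ray_graph_topology G) = points G"
  by (metis M.topspace_mtopology mtopology_eq)

lemma hyperspace_subset: "A \<in> hyperspace n G \<Longrightarrow> A \<subseteq> points G"
  using closedin_subset by (fastforce simp: hyperspace_def)

lemma ray_coord_lipschitz:
  assumes "x \<in> points G" "y \<in> points G"
  shows "\<bar>ray_coord r x - ray_coord r y\<bar> \<le> path_dist G x y"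
proof (rule path_dist_ge[OF assms])
  fix l assume "walk G x y l"
  then show "\<bar>ray_coord r x - ray_coord r y\<bar> \<le> l"
    by (rule walk_lipschitz) (auto elim!: segment.cases)
qed

lemma continuous_map_ray_coord:
  "continuous_map (ray_graph_topology G) euclideanreal (ray_coord r)"
proof -
  have "continuous_map M.mtopology Met_TC.mtopology (ray_coord r :: ('v, 'e, 'r) point \<Rightarrow> real)"
    unfolding M.metric_continuous_map[OF Met_TC.Metric_space_axioms]
  proof (intro conjI ballI allI impI)
    fix a :: "('v, 'e, 'r) point" and \<epsilon> :: real assume a: "a \<in> points G" and "\<epsilon> > 0"
    moreover have "dist (ray_coord r a) (ray_coord r x) < \<epsilon>"
      if "x \<in> points G" "path_dist G a x < \<epsilon>" for x
      using ray_coord_lipschitz[OF a that(1), of r] that(2) by (simp add: dist_real_def)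
    ultimately show "\<exists>\<delta>>0. \<forall>x. x \<in> points G \<and> path_dist G a x < \<delta> \<longrightarrow>
        dist (ray_coord r a) (ray_coord r x) < \<epsilon>"
      by blast
  qed auto
  then show ?thesis
    by (simp add: mtopology_eq)
qed

lemma closedin_ray_coord_le: "closedin (ray_graph_topology G) {p \<in> points G. ray_coord r p \<le> c}"
  using closedin_continuous_map_preimage[OF continuous_map_ray_coord[of r], of "{..c}"]
  by simp

lemma closedin_ray_coords_le:
  "closedin (ray_graph_topology G) {p \<in> points G. \<forall>r\<in>R. ray_coord r p \<le> c r}"
proof (cases "R = {}")
  case True
  then show ?thesis
    using closedin_topspace[of "ray_graph_topology G"] by simp
next
  case False
  then have "{p \<in> points G. \<forall>r\<in>R. ray_coord r p \<le> c r}
      = (\<Inter>r\<in>R. {p \<in> points G. ray_coord r p \<le> c r})"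
    by auto
  also have "closedin (ray_graph_topology G) \<dots>"
    using False closedin_ray_coord_le by (intro closedin_INT) auto
  finally show ?thesis .
qed


section \<open>Rays on which a closed set is unbounded\<close>

text \<open>
  Some component \<open>C\<close> of \<open>A\<close> is unbounded on \<open>r\<close>, as there are only finitely many. Its image
  under the ray coordinate is an unbounded interval of reals, and a positive value of the coordinate
  determines the point.
\<close>

lemma contains_tail:
  assumes A: "A \<in> hyperspace n G" and r: "r \<in> unbounded_rays G A"
  shows "\<exists>c. \<forall>p\<in>points G. c < ray_coord r p \<longrightarrow> p \<in> A"
proof -
  let ?K = "connected_components_of (subtopology (ray_graph_topology G) A)"
  have fin: "finite ?K" and AP: "A \<subseteq> points G" and UK: "\<Union>?K = A"
    using A hyperspace_subset[OF A]
    by (auto simp: hyperspace_def Union_connected_components_of)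
  obtain C where C: "C \<in> ?K" and unb: "\<And>c. \<exists>p\<in>C. c < ray_coord r p"
  proof (rule ccontr)
    assume "\<not> thesis"
    then have "\<forall>C\<in>?K. \<exists>c. \<forall>p\<in>C. ray_coord r p \<le> c"
      using that by (meson not_le)
    then obtain b where b: "\<And>C p. C \<in> ?K \<Longrightarrow> p \<in> C \<Longrightarrow> ray_coord r p \<le> b C"
      by metis
    obtain p where p: "p \<in> A" "(\<Sum>C\<in>?K. \<bar>b C\<bar>) < ray_coord r p"
      using r by (auto simp: unbounded_rays_def)
    then obtain C where C: "C \<in> ?K" "p \<in> C" using UK by blast
    then have "ray_coord r p \<le> \<bar>b C\<bar>" using b by fastforce
    also have "\<dots> \<le> (\<Sum>C\<in>?K. \<bar>b C\<bar>)"
      using fin C by (intro member_le_sum) auto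
    finally show False using p by simp
  qed
  have "connectedin (ray_graph_topology G) C"
    using connectedin_connected_components_of[OF C] by (simp add: connectedin_subtopology)
  then have conn: "connected (ray_coord r ` C)"
    using connectedin_continuous_map_image[OF continuous_map_ray_coord] by fastforce
  obtain p0 where p0: "p0 \<in> C" "0 < ray_coord r p0" using unb by blast
  have "q \<in> A" if q: "ray_coord r p0 < ray_coord r q" for q
  proof -
    obtain p1 where p1: "p1 \<in> C" "ray_coord r q < ray_coord r p1" using unb by blast
    have "ray_coord r q \<in> ray_coord r ` C"
      using connectedD_interval[OF conn, of "ray_coord r p0" "ray_coord r p1"] p0 p1 q by auto
    then obtain x where "x \<in> C" "ray_coord r x = ray_coord r q" by auto
    moreover then have "x = q"
      using ray_coord_pos[of r x] ray_coord_pos[of r q] p0 q by simp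
    ultimately show ?thesis using C UK by blast
  qed
  then show ?thesis by blast
qed

lemma unbounded_rays_mono_hausdorff:
  assumes "A \<subseteq> neighborhood G B \<epsilon>" "B \<subseteq> points G"
  shows "unbounded_rays G A \<subseteq> unbounded_rays G B"
proof
  fix r assume r: "r \<in> unbounded_rays G A"
  have "\<exists>q\<in>B. c < ray_coord r q" for c
  proof -
    obtain p where p: "p \<in> A" "c + \<epsilon> < ray_coord r p"
      using r by (auto simp: unbounded_rays_def)
    then obtain q where "q \<in> B" "path_dist G p q < \<epsilon>" "p \<in> points G"
      using assms by (auto simp: neighborhood_def)
    moreover then have "\<bar>ray_coord r p - ray_coord r q\<bar> \<le> path_dist G p q"
      using assms by (intro ray_coord_lipschitz) auto
    ultimately show ?thesis using p by (intro bexI[of _ q]) auto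
  qed
  then show "r \<in> unbounded_rays G B"
    using r by (auto simp: unbounded_rays_def)
qed

lemma unbounded_rays_eq:
  assumes "A \<subseteq> points G" "B \<subseteq> points G" "hausdorff_dist G A B < ereal \<epsilon>"
  shows "unbounded_rays G A = unbounded_rays G B"
proof -
  obtain \<delta> where "A \<subseteq> neighborhood G B \<delta>" "B \<subseteq> neighborhood G A \<delta>"
    using assms(3) by (auto simp: hausdorff_dist_def Inf_less_iff)
  then show ?thesis
    using unbounded_rays_mono_hausdorff assms(1,2) by blast
qed

text \<open>
  The invariant is constant on Hausdorff balls, so every condition on it is open, and hence also
  closed.
\<close>

lemma openin_unbounded_rays:
  "openin (hyperspace_topology n G) {A \<in> hyperspace n G. unbounded_rays G A \<in> \<R>}"
proof -
  have ball: "{B \<in> hyperspace n G. hausdorff_dist G A B < ereal 1}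
      \<subseteq> {A \<in> hyperspace n G. unbounded_rays G A \<in> \<R>}"
    if "A \<in> hyperspace n G" "unbounded_rays G A \<in> \<R>" for A
  proof
    fix B assume B: "B \<in> {B \<in> hyperspace n G. hausdorff_dist G A B < ereal 1}"
    then have "unbounded_rays G A = unbounded_rays G B"
      using that hyperspace_subset by (intro unbounded_rays_eq) auto
    then show "B \<in> {A \<in> hyperspace n G. unbounded_rays G A \<in> \<R>}"
      using that B by simp
  qed
  show ?thesis
    unfolding openin_hyperspace_topology
  proof (intro conjI ballI)
    fix A assume "A \<in> {A \<in> hyperspace n G. unbounded_rays G A \<in> \<R>}"
    then have "A \<in> hyperspace n G" "unbounded_rays G A \<in> \<R>" by simp_all
    then show "\<exists>\<epsilon>>0. {B \<in> hyperspace n G. hausdorff_dist G A B < ereal \<epsilon>}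
        \<subseteq> {A \<in> hyperspace n G. unbounded_rays G A \<in> \<R>}"
      using ball by (intro exI[of _ "1 :: real"] conjI zero_less_one)
  qed simp
qed

lemma path_component_unbounded_rays:
  assumes "path_component_of (hyperspace_topology n G) A B"
  shows "unbounded_rays G A = unbounded_rays G B"
proof -
  let ?T = "hyperspace_topology n G"
  let ?S = "{C \<in> hyperspace n G. unbounded_rays G C \<in> {unbounded_rays G A}}"
  have "topspace ?T - ?S = {C \<in> hyperspace n G. unbounded_rays G C \<in> - {unbounded_rays G A}}"
    by (auto simp: topspace_hyperspace_topology)
  then have closed: "closedin ?T ?S"
    using openin_unbounded_rays[of n "- {unbounded_rays G A}"]
    by (simp add: closedin_def topspace_hyperspace_topology)
  obtain C where C: "connectedin ?T C" "A \<in> C" "B \<in> C"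
  proof -
    obtain g where g: "pathin ?T g" "g 0 = A" "g 1 = B"
      using assms by (auto simp: path_component_of_def)
    have "connectedin (top_of_set {0..1}) {0..1 :: real}"
      by (simp add: connectedin_subtopology)
    then have "connectedin ?T (g ` {0..1})"
      using g(1) connectedin_continuous_map_image unfolding pathin_def by blast
    then show thesis
      using that g by force
  qed
  have "C \<subseteq> ?S \<or> disjnt C ?S"
    using connectedin_clopen_cases[OF C(1) closed openin_unbounded_rays] .
  moreover have "A \<in> ?S"
    using C connectedin_subset_topspace[OF C(1)] by (auto simp: topspace_hyperspace_topology)
  ultimately show ?thesis
    using C by (auto simp: disjnt_iff)
qed


section \<open>Adjoining an arc\<close>

lemma hyperspace_superset:
  assumes A: "A \<in> hyperspace n G" and "A \<subseteq> B" and B: "closedin (ray_graph_topology G) B"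
    and "\<And>x. x \<in> B \<Longrightarrow>
      \<exists>C. connectedin (ray_graph_topology G) C \<and> C \<subseteq> B \<and> x \<in> C \<and> C \<inter> A \<noteq> {}"
  shows "B \<in> hyperspace n G"
proof -
  have *: "A \<noteq> {}" "finite (connected_components_of (subtopology (ray_graph_topology G) A))"
    "card (connected_components_of (subtopology (ray_graph_topology G) A)) \<le> n"
    using A by (simp_all add: hyperspace_def)
  have "B \<noteq> {}" using *(1) assms(2) by auto
  then show ?thesis
    using connected_components_superset[OF assms(2) closedin_subset[OF B] assms(4) *(2)] *(3) B
    by (simp add: hyperspace_def)
qed

lemma lipschitz_arc_continuous:
  assumes "lipschitz_arc G C"
  obtains \<sigma> :: "real \<Rightarrow> _" and a b where "C = \<sigma> ` {a..b}"
    and "continuous_map (top_of_set {a..b}) (ray_graph_topology G) \<sigma>"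
proof -
  obtain \<sigma> a b where C: "C = \<sigma> ` {a..b}" "C \<subseteq> points G"
    and lip: "\<And>s t. s \<in> {a..b} \<Longrightarrow> t \<in> {a..b} \<Longrightarrow> path_dist G (\<sigma> s) (\<sigma> t) \<le> \<bar>s - t\<bar>"
    using assms unfolding lipschitz_arc_def by metis
  have "continuous_map (top_of_set {a..b}) M.mtopology \<sigma>"
    unfolding M.continuous_map_to_metric
  proof (intro ballI allI impI)
    fix s \<epsilon> :: real assume "s \<in> topspace (top_of_set {a..b})" and \<epsilon>: "\<epsilon> > 0"
    then have s: "s \<in> {a..b}" by simp
    have "\<sigma> t \<in> M.mball (\<sigma> s) \<epsilon>" if t: "t \<in> {a..b} \<inter> ball s \<epsilon>" for t
    proof -
      have "path_dist G (\<sigma> s) (\<sigma> t) < \<epsilon>"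
        using lip[OF s, of t] t by (simp add: dist_real_def)
      moreover have "\<sigma> s \<in> points G" "\<sigma> t \<in> points G"
        using C s t by auto
      ultimately show ?thesis by simp
    qed
    moreover have "openin (top_of_set {a..b}) ({a..b} \<inter> ball s \<epsilon>)"
      by (simp add: openin_open_Int)
    moreover have "s \<in> {a..b} \<inter> ball s \<epsilon>"
      using s \<epsilon> by simp
    ultimately show "\<exists>U. openin (top_of_set {a..b}) U \<and> s \<in> U \<and> (\<forall>t\<in>U. \<sigma> t \<in> M.mball (\<sigma> s) \<epsilon>)"
      by blast
  qed
  then show thesis
    using that[OF C(1)] by (simp add: mtopology_eq)
qed

lemma lipschitz_arc_closedin:
  assumes "lipschitz_arc G C"
  shows "closedin (ray_graph_topology G) C"
proof -
  obtain \<sigma> :: "real \<Rightarrow> _" and a b where C: "C = \<sigma> ` {a..b}"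
    and cont: "continuous_map (top_of_set {a..b}) (ray_graph_topology G) \<sigma>"
    using lipschitz_arc_continuous[OF assms] .
  have "compactin (top_of_set {a..b}) {a..b}"
    by (simp add: compactin_subtopology)
  then have "compactin (ray_graph_topology G) C"
    unfolding C using cont by (rule image_compactin)
  then show ?thesis
    using M.Hausdorff_space_mtopology by (simp add: mtopology_eq compactin_imp_closedin)
qed

lemma lipschitz_arc_connectedin:
  assumes "lipschitz_arc G C"
  shows "connectedin (ray_graph_topology G) C"
proof -
  obtain \<sigma> :: "real \<Rightarrow> _" and a b where C: "C = \<sigma> ` {a..b}"
    and cont: "continuous_map (top_of_set {a..b}) (ray_graph_topology G) \<sigma>"
    using lipschitz_arc_continuous[OF assms] .
  have "connectedin (top_of_set {a..b}) {a..b}"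
    by (simp add: connectedin_subtopology)
  then show ?thesis
    unfolding C by (rule connectedin_continuous_map_image[OF cont])
qed

text \<open>
  The arc is grown in both directions at once from a point \<open>\<sigma> c\<close> of \<open>A\<close>: at time \<open>t\<close> it is the image of
  an interval around \<open>c\<close> whose endpoints move linearly from \<open>c\<close> to \<open>a\<close> and \<open>b\<close>. Each stage is
  connected and meets \<open>A\<close>, so the number of components does not increase.
\<close>

lemma path_component_adjoin_arc:
  assumes A: "A \<in> hyperspace n G" and C: "lipschitz_arc G C" and "A \<inter> C \<noteq> {}"
  shows "path_component_of (hyperspace_topology n G) A (A \<union> C)"
proof -
  obtain \<sigma> a b where C: "C = \<sigma> ` {a..b}" "C \<subseteq> points G"
    and lip: "\<And>s t. s \<in> {a..b} \<Longrightarrow> t \<in> {a..b} \<Longrightarrow> path_dist G (\<sigma> s) (\<sigma> t) \<le> \<bar>s - t\<bar>"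
    using C unfolding lipschitz_arc_def by metis
  obtain c where c: "a \<le> c" "c \<le> b" "\<sigma> c \<in> A" using assms(3) C by auto
  define lo hi where "lo t = c - t * (c - a)" and "hi t = c + t * (b - c)" for t
  have bounds: "a \<le> lo t" "lo t \<le> c" "c \<le> hi t" "hi t \<le> b" if "t \<in> {0..1}" for t
    using that c mult_right_mono[of t 1 "c - a"] mult_right_mono[of t 1 "b - c"]
    by (auto simp: lo_def hi_def)
  define g where "g t = A \<union> \<sigma> ` {lo t..hi t}" for t
  have AP: "A \<subseteq> points G" using hyperspace_subset[OF A] .
  have "path_component_of (hyperspace_topology n G) (g 0) (g 1)"
  proof (rule lipschitz_imp_path_component_of[where L = "b - a"])
    fix t :: real assume t: "t \<in> {0..1}"
    have arc: "lipschitz_arc G (\<sigma> ` {lo t..hi t})"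
      unfolding lipschitz_arc_def
      using bounds[OF t] C lip by (intro exI[of _ \<sigma>] exI[of _ "lo t"] exI[of _ "hi t"]) auto
    show "g t \<in> hyperspace n G"
    proof (rule hyperspace_superset[OF A])
      show "closedin (ray_graph_topology G) (g t)"
        unfolding g_def using A lipschitz_arc_closedin[OF arc]
        by (intro closedin_Un) (auto simp: hyperspace_def)
      fix x assume "x \<in> g t"
      then consider "x \<in> A" | "x \<in> \<sigma> ` {lo t..hi t}" by (auto simp: g_def)
      then show "\<exists>C. connectedin (ray_graph_topology G) C \<and> C \<subseteq> g t \<and> x \<in> C \<and> C \<inter> A \<noteq> {}"
      proof cases
        case 1
        then show ?thesis using AP by (intro exI[of _ "{x}"]) (auto simp: g_def)
      next
        case 2
        moreover have "\<sigma> c \<in> \<sigma> ` {lo t..hi t} \<inter> A"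
          using bounds[OF t] c by auto
        ultimately show ?thesis
          using lipschitz_arc_connectedin[OF arc]
          by (intro exI[of _ "\<sigma> ` {lo t..hi t}"]) (auto simp: g_def)
      qed
    qed (auto simp: g_def)
  next
    fix s t \<epsilon> :: real
    assume s: "s \<in> {0..1}" and t: "t \<in> {0..1}" and \<epsilon>: "(b - a) * \<bar>s - t\<bar> < \<epsilon>"
    then have "\<epsilon> > 0"
      using c by (smt (verit) mult_nonneg_nonneg)
    show "g s \<subseteq> neighborhood G (g t) \<epsilon>"
    proof
      fix x assume "x \<in> g s"
      then consider "x \<in> A" | u where "u \<in> {lo s..hi s}" "x = \<sigma> u" by (auto simp: g_def)
      then show "x \<in> neighborhood G (g t) \<epsilon>"
      proof cases
        case 1
        then show ?thesis
          using AP \<open>\<epsilon> > 0\<close> by (force simp: g_def neighborhood_def)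
      next
        case 2
        \<comment> \<open>The parameter nearest to \<open>u\<close> in the interval reached at time \<open>t\<close>.\<close>
        define w where "w = max (lo t) (min u (hi t))"
        have w: "w \<in> {lo t..hi t}" using bounds[OF t] by (auto simp: w_def)
        have "lo s - lo t = (c - a) * (t - s)" "hi s - hi t = (b - c) * (s - t)"
          by (auto simp: lo_def hi_def algebra_simps)
        then have "\<bar>lo s - lo t\<bar> = (c - a) * \<bar>s - t\<bar>" "\<bar>hi s - hi t\<bar> = (b - c) * \<bar>s - t\<bar>"
          using c by (auto simp: abs_mult abs_minus_commute)
        moreover have "(c - a) * \<bar>s - t\<bar> \<le> (b - a) * \<bar>s - t\<bar>"
          "(b - c) * \<bar>s - t\<bar> \<le> (b - a) * \<bar>s - t\<bar>"
          using c by (auto intro!: mult_right_mono)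
        ultimately have "\<bar>lo s - lo t\<bar> < \<epsilon>" "\<bar>hi s - hi t\<bar> < \<epsilon>"
          using \<epsilon> by linarith+
        then have "\<bar>u - w\<bar> < \<epsilon>"
          using 2 \<open>\<epsilon> > 0\<close> by (auto simp: w_def max_def min_def)
        moreover have "u \<in> {a..b}" "w \<in> {a..b}"
          using 2 w bounds[OF s] bounds[OF t] by auto
        ultimately have "path_dist G (\<sigma> u) (\<sigma> w) < \<epsilon>" "\<sigma> u \<in> points G"
          using lip[of u w] C by auto
        then show ?thesis using 2 w by (auto simp: neighborhood_def g_def)
      qed
    qed
  qed (use c in auto)
  moreover have "g 0 = A" "g 1 = A \<union> C"
    using c C by (auto simp: g_def lo_def hi_def)
  ultimately show ?thesis by simp
qed

section \<open>Adjoining a truncation of the graph\<close>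

lemma lipschitz_arc_edge: "e \<in> edges G \<Longrightarrow> lipschitz_arc G (edge_point G e ` {0..1})"
  unfolding lipschitz_arc_def
  by (intro exI[of _ "edge_point G e"] exI[of _ 0] exI[of _ 1])
    (auto intro!: path_dist_le segment_walk segment.edge edge_point_in)

lemma lipschitz_arc_ray: "r \<in> rays G \<Longrightarrow> lipschitz_arc G (ray_point G r ` {0..c})"
  unfolding lipschitz_arc_def
  by (intro exI[of _ "ray_point G r"] exI[of _ 0] exI[of _ c])
    (auto intro!: path_dist_le segment_walk segment.ray ray_point_in)

lemma truncation_eq:
  assumes c: "\<And>r. r \<in> rays G \<Longrightarrow> 0 \<le> c r"
  shows "truncation G c = Vertex ` verts G \<union> (\<Union>e\<in>edges G. edge_point G e ` {0..1})
    \<union> (\<Union>r\<in>rays G. ray_point G r ` {0..c r})"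
proof (intro equalityI subsetI)
  fix p assume p: "p \<in> truncation G c"
  show "p \<in> Vertex ` verts G \<union> (\<Union>e\<in>edges G. edge_point G e ` {0..1})
    \<union> (\<Union>r\<in>rays G. ray_point G r ` {0..c r})"
  proof (cases p)
    case (Vertex v)
    then show ?thesis using p by (auto simp: truncation_def points_def)
  next
    case (Edge_Point e t)
    then have "e \<in> edges G" "t \<in> {0..1}" "p = edge_point G e t"
      using p by (auto simp: truncation_def points_def edge_point_def)
    then show ?thesis by blast
  next
    case (Ray_Point r t)
    then have "r \<in> rays G" "t \<in> {0..c r}" "p = ray_point G r t"
      using p by (auto simp: truncation_def points_def ray_point_def)
    then show ?thesis by blast
  qed
next
  fix p assume "p \<in> Vertex ` verts G \<union> (\<Union>e\<in>edges G. edge_point G e ` {0..1})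
    \<union> (\<Union>r\<in>rays G. ray_point G r ` {0..c r})"
  then show "p \<in> truncation G c"
  proof (elim UnE)
    assume "p \<in> Vertex ` verts G"
    then show "p \<in> truncation G c" using c by (auto simp: truncation_def points_def)
  qed (use c edge_point_in ray_point_in in \<open>auto simp: truncation_def\<close>)
qed

text \<open>
  The truncation is the finite union of the closed edges and of initial segments of the rays,
  together with the vertices. Suppose that a set containing \<open>A\<close> already includes every arc that it meets. The
  set contains a vertex, because it meets the truncation and each arc contains a vertex. With a
  vertex it contains every edge at that vertex, hence all vertices by connectedness of the graph,
  and hence all arcs.
\<close>

lemma path_component_adjoin_truncation:
  assumes A: "A \<in> hyperspace n G" and c: "\<And>r. r \<in> rays G \<Longrightarrow> 0 \<le> c r"
    and meet: "A \<inter> truncation G c \<noteq> {}"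
  shows "path_component_of (hyperspace_topology n G) A (A \<union> truncation G c)"
proof -
  define \<C> where "\<C> = (\<lambda>e. edge_point G e ` {0..1}) ` edges G
    \<union> (\<lambda>r. ray_point G r ` {0..c r}) ` rays G"
  have trunc: "truncation G c = Vertex ` verts G \<union> \<Union>\<C>"
    using truncation_eq[OF c] by (simp add: \<C>_def Un_assoc)
  have "finite \<C>" using finite_edges finite_rays by (simp add: \<C>_def)
  moreover have "lipschitz_arc G C" if "C \<in> \<C>" for C
    using that lipschitz_arc_edge lipschitz_arc_ray by (auto simp: \<C>_def)
  ultimately obtain \<D> where \<D>: "\<D> \<subseteq> \<C>"
    and pc: "path_component_of (hyperspace_topology n G) A (A \<union> \<Union>\<D>)"
    and sat: "\<And>C. C \<in> \<C> \<Longrightarrow> C \<inter> (A \<union> \<Union>\<D>) \<noteq> {} \<Longrightarrow> C \<in> \<D>"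
    using path_component_of_saturated_Union[of A "hyperspace_topology n G" \<C>] A
      path_component_adjoin_arc
    by (metis Int_commute topspace_hyperspace_topology)
  let ?B = "A \<union> \<Union>\<D>"
  have in_B: "y \<in> ?B" if "C \<in> \<C>" "x \<in> C" "x \<in> ?B" "y \<in> C" for C x y
    using sat that by blast
  have edge_ends: "Vertex (fst (ends G e)) \<in> edge_point G e ` {0..1}"
    "Vertex (snd (ends G e)) \<in> edge_point G e ` {0..1}" for e
    by (auto simp: edge_point_def image_iff intro: bexI[of _ 0] bexI[of _ 1])
  have ray_end: "Vertex (base G r) \<in> ray_point G r ` {0..c r}" if "r \<in> rays G" for r
    using c[OF that] by (auto simp: ray_point_def image_iff intro: bexI[of _ 0])
  have vertex_in: "\<exists>v\<in>verts G. Vertex v \<in> C" if "C \<in> \<C>" for C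
  proof -
    from that consider e where "e \<in> edges G" "C = edge_point G e ` {0..1}"
      | r where "r \<in> rays G" "C = ray_point G r ` {0..c r}"
      by (auto simp: \<C>_def)
    then show ?thesis
    proof cases
      case 1
      then show ?thesis using edge_ends(1)[of e] ends_in[of e] by (metis mem_Times_iff)
    next
      case 2
      then show ?thesis using ray_end base_in by blast
    qed
  qed
  obtain u where u: "u \<in> verts G" "Vertex u \<in> ?B"
  proof -
    obtain x where "x \<in> A" "x \<in> Vertex ` verts G \<or> (\<exists>C\<in>\<C>. x \<in> C)"
      using meet unfolding trunc by blast
    then show thesis
    proof (elim disjE bexE)
      fix C assume "x \<in> A" "C \<in> \<C>" "x \<in> C"
      then show thesis
        using vertex_in[of C] in_B[of C x] that by blast
    qed (use that in blast)
  qed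
  have verts_B: "Vertex v \<in> ?B" if "v \<in> verts G" for v
    using connected[OF u(1) that]
  proof (induction rule: rtrancl_induct)
    case base
    show ?case using u by simp
  next
    case (step v w)
    then obtain e where e: "e \<in> edges G" "ends G e = (v, w) \<or> ends G e = (w, v)"
      by force
    then have "edge_point G e ` {0..1} \<in> \<C>" by (auto simp: \<C>_def)
    then show ?case
      using in_B[of "edge_point G e ` {0..1}" "Vertex v" "Vertex w"] step.IH e edge_ends[of e]
      by auto
  qed
  have "\<C> \<subseteq> \<D>"
  proof
    fix C assume C: "C \<in> \<C>"
    then obtain v where "v \<in> verts G" "Vertex v \<in> C" using vertex_in by blast
    then have "C \<inter> ?B \<noteq> {}" using verts_B by (meson disjoint_iff)
    with C show "C \<in> \<D>" by (rule sat)
  qed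
  with \<D> have "\<D> = \<C>" by simp
  moreover have "Vertex ` verts G \<subseteq> ?B" using verts_B by (intro image_subsetI)
  ultimately have "?B = A \<union> truncation G c"
    unfolding trunc by (metis Un_left_commute subset_Un_eq)
  then show ?thesis using pc by simp
qed


section \<open>Path components are classified by the unbounded rays\<close>

lemma hyperspace_eventually_constant_on_rays:
  assumes A: "A \<in> hyperspace n G"
  shows "\<exists>c. \<forall>r\<in>rays G. \<forall>p\<in>points G. c r < ray_coord r p \<longrightarrow> (p \<in> A \<longleftrightarrow> r \<in> unbounded_rays G A)"
proof -
  have "\<exists>c. \<forall>p\<in>points G. c < ray_coord r p \<longrightarrow> (p \<in> A \<longleftrightarrow> r \<in> unbounded_rays G A)"
    if r: "r \<in> rays G" for r
  proof (cases "r \<in> unbounded_rays G A")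
    case True
    then show ?thesis using contains_tail[OF A] by blast
  next
    case False
    then show ?thesis using r by (auto simp: unbounded_rays_def not_less[symmetric])
  qed
  then show ?thesis by (rule bchoice[OF ballI])
qed

text \<open>
  If the rays are cut off beyond the thresholds for both sets, then adjoining the truncation makes
  \<open>A\<close> and \<open>B\<close> equal.
\<close>

lemma path_component_if_unbounded_rays_eq:
  assumes A: "A \<in> hyperspace n G" and B: "B \<in> hyperspace n G"
    and eq: "unbounded_rays G A = unbounded_rays G B"
  shows "path_component_of (hyperspace_topology n G) A B"
proof -
  obtain cA where cA: "\<And>r p. r \<in> rays G \<Longrightarrow> p \<in> points G \<Longrightarrow> cA r < ray_coord r p
      \<Longrightarrow> p \<in> A \<longleftrightarrow> r \<in> unbounded_rays G A"
    using hyperspace_eventually_constant_on_rays[OF A] by blast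
  obtain cB where cB: "\<And>r p. r \<in> rays G \<Longrightarrow> p \<in> points G \<Longrightarrow> cB r < ray_coord r p
      \<Longrightarrow> p \<in> B \<longleftrightarrow> r \<in> unbounded_rays G B"
    using hyperspace_eventually_constant_on_rays[OF B] by blast
  obtain a b where ab: "a \<in> A" "b \<in> B" using A B by (auto simp: hyperspace_def)
  \<comment> \<open>The last two summands put \<open>a\<close> and \<open>b\<close> into the truncation, so that both sets meet it.\<close>
  define c where "c r = \<bar>cA r\<bar> + \<bar>cB r\<bar> + \<bar>ray_coord r a\<bar> + \<bar>ray_coord r b\<bar>" for r
  have "a \<in> truncation G c" "b \<in> truncation G c"
    using ab hyperspace_subset[OF A] hyperspace_subset[OF B] by (auto simp: truncation_def c_def)
  then have "path_component_of (hyperspace_topology n G) A (A \<union> truncation G c)"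
    "path_component_of (hyperspace_topology n G) B (B \<union> truncation G c)"
    using A B ab by (auto intro!: path_component_adjoin_truncation simp: c_def)
  moreover have "p \<in> A \<longleftrightarrow> p \<in> B" if p: "p \<in> points G" "p \<notin> truncation G c" for p
  proof -
    obtain r where "r \<in> rays G" "c r < ray_coord r p"
      using p by (auto simp: truncation_def not_le)
    then show ?thesis
      using cA[of r p] cB[of r p] p(1) eq by (auto simp: c_def)
  qed
  then have "A \<union> truncation G c = B \<union> truncation G c"
    using hyperspace_subset[OF A] hyperspace_subset[OF B] by blast
  ultimately show ?thesis
    by (metis path_component_of_sym path_component_of_trans)
qed

text \<open>
  The witness is the core, consisting of the vertices and edges, together with the rays in \<open>R\<close>. The
  core lies in the hyperspace because adjoining it to one of its vertices is a path in the hyperspace;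
  each point on a ray in \<open>R\<close> is then connected to the core along that ray.
\<close>

lemma unbounded_rays_surj:
  assumes "n \<ge> 1" and R: "R \<subseteq> rays G"
  shows "\<exists>A\<in>hyperspace n G. unbounded_rays G A = R"
proof -
  let ?X = "ray_graph_topology G"
  let ?core = "truncation G (\<lambda>_. 0)"
  define A where "A = {p \<in> points G. \<forall>r\<in>rays G - R. ray_coord r p \<le> 0}"
  obtain v where v: "v \<in> verts G" using verts_nonempty by blast
  then have vP: "Vertex v \<in> points G" by (auto simp: points_def)
  have "closedin ?X {Vertex v}"
    using closedin_Hausdorff_singleton M.Hausdorff_space_mtopology vP
    by (metis mtopology_eq topspace_ray_graph_topology)
  moreover have "connected_components_of (subtopology ?X {Vertex v}) = {{Vertex v}}"
    using vP connectedin_sing[of ?X "Vertex v"]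
    by (auto simp: connected_components_of_eq_singleton connectedin_def
        simp flip: null_topspace_iff_trivial)
  ultimately have "{Vertex v} \<in> hyperspace n G"
    using assms by (simp add: hyperspace_def)
  then have "path_component_of (hyperspace_topology n G) {Vertex v} ({Vertex v} \<union> ?core)"
    using vP by (intro path_component_adjoin_truncation) (auto simp: truncation_def)
  moreover have v_core: "Vertex v \<in> ?core"
    using vP by (auto simp: truncation_def)
  ultimately have core: "?core \<in> hyperspace n G"
    using path_component_in_topspace topspace_hyperspace_topology
    by (metis insert_absorb insert_is_Un)
  have "A \<in> hyperspace n G"
  proof (rule hyperspace_superset[OF core])
    show "?core \<subseteq> A" by (auto simp: truncation_def A_def)
    show "closedin ?X A" unfolding A_def by (rule closedin_ray_coords_le)
    fix x assume x: "x \<in> A"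
    show "\<exists>C. connectedin ?X C \<and> C \<subseteq> A \<and> x \<in> C \<and> C \<inter> ?core \<noteq> {}"
    proof (cases "x \<in> ?core")
      case True
      then show ?thesis using x by (intro exI[of _ "{x}"]) (auto simp: A_def)
    next
      case False
      then obtain r where r: "r \<in> rays G" "0 < ray_coord r x"
        using x by (auto simp: truncation_def A_def not_le)
      then have "r \<in> R" using x by (force simp: A_def)
      define t where "t = ray_coord r x"
      have xt: "x = ray_point G r t"
        using ray_coord_pos[OF r(2)] r(2) by (simp add: ray_point_def t_def)
      have C: "ray_point G r ` {0..t} \<subseteq> A"
        using r \<open>r \<in> R\<close> ray_point_in by (auto simp: A_def)
      moreover have "ray_point G r 0 \<in> ray_point G r ` {0..t} \<inter> ?core"
        using r ray_point_in by (auto simp: truncation_def t_def)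
      moreover have "x \<in> ray_point G r ` {0..t}"
        using xt r by (auto simp: t_def)
      ultimately show ?thesis
        using lipschitz_arc_connectedin[OF lipschitz_arc_ray[OF r(1)]] by blast
    qed
  qed
  moreover have "unbounded_rays G A = R"
  proof (intro equalityI subsetI)
    fix r assume "r \<in> unbounded_rays G A"
    then obtain p where "r \<in> rays G" "p \<in> A" "0 < ray_coord r p"
      unfolding unbounded_rays_def by blast
    then show "r \<in> R" by (force simp: A_def)
  next
    fix r assume r: "r \<in> R"
    have "\<exists>p\<in>A. c < ray_coord r p" for c
      using r R ray_point_in[of r "\<bar>c\<bar> + 1"]
      by (intro bexI[of _ "ray_point G r (\<bar>c\<bar> + 1)"]) (auto simp: A_def)
    then show "r \<in> unbounded_rays G A"
      using r R by (auto simp: unbounded_rays_def)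
  qed
  ultimately show ?thesis by blast
qed

lemma card_path_components_hyperspace:
  assumes "n \<ge> 1"
  shows "card (path_components_of (hyperspace_topology n G)) = 2 ^ card (rays G)"
proof -
  define f where "f R = {A \<in> hyperspace n G. unbounded_rays G A = R}" for R
  have component: "path_component_of_set (hyperspace_topology n G) A = f (unbounded_rays G A)"
    if A: "A \<in> hyperspace n G" for A
  proof -
    have "path_component_of (hyperspace_topology n G) A B
        \<longleftrightarrow> B \<in> hyperspace n G \<and> unbounded_rays G B = unbounded_rays G A" for B
    proof
      assume "path_component_of (hyperspace_topology n G) A B"
      then show "B \<in> hyperspace n G \<and> unbounded_rays G B = unbounded_rays G A"
        using path_component_unbounded_rays path_component_in_topspace
        by (metis topspace_hyperspace_topology)
    qed (use path_component_if_unbounded_rays_eq[OF A] in simp)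
    then show ?thesis unfolding f_def by (intro Collect_cong)
  qed
  have surj: "unbounded_rays G ` hyperspace n G = Pow (rays G)"
  proof (intro equalityI subsetI)
    fix R assume "R \<in> Pow (rays G)"
    then show "R \<in> unbounded_rays G ` hyperspace n G"
      using unbounded_rays_surj[OF assms, of R] by blast
  qed (auto simp: unbounded_rays_def)
  have "path_components_of (hyperspace_topology n G)
      = (\<lambda>A. f (unbounded_rays G A)) ` hyperspace n G"
    unfolding path_components_of_def topspace_hyperspace_topology
    using component by (intro image_cong) simp_all
  also have "\<dots> = f ` Pow (rays G)"
    unfolding surj[symmetric] by (simp add: image_image)
  finally have "path_components_of (hyperspace_topology n G) = f ` Pow (rays G)" .
  moreover have "inj_on f (Pow (rays G))"
  proof (rule inj_onI)
    fix R S assume "R \<in> Pow (rays G)" and eq: "f R = f S"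
    then obtain A where "A \<in> hyperspace n G" "unbounded_rays G A = R"
      using unbounded_rays_surj[OF assms, of R] by blast
    then have "A \<in> f S" using eq by (auto simp: f_def)
    then show "R = S" using \<open>unbounded_rays G A = R\<close> by (simp add: f_def)
  qed
  ultimately show ?thesis
    by (simp add: card_image card_Pow finite_rays)
qed

end

theorem theorem5p3:
  fixes G :: "('v, 'e, 'r) ray_graph" and k n :: nat
  assumes "finite_connected_ray_graph G"
    and "card (rays G) = k"
    and "n \<ge> 1"
  shows "card (path_components_of (hyperspace_topology n G)) = 2 ^ k"
  using finite_connected_ray_graph.card_path_components_hyperspace[OF assms(1,3)] assms(2) by simp

end
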